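(* Let $P$ be a set of $n$ points in general position in the plane. Then there are three points $p_1,p_2,p_3\in\mathbb{R}^2$ such that (1) every closed halfplane containing at least one of $p_1,p_2,p_3$ contains at least $\frac{n}{6}$ points of $P$, and (2) every closed halfplane containing all of $p_1,p_2,p_3$ contains at least $\frac{n}{2}$ points of $P$.
   Context: General position means no three points of $P$ are collinear. *)

theory Defs
  imports "HOL-Analysis.Analysis"
begin

definition closed_halfplane :: "(real^2) set \<Rightarrow> bool" where
  "closed_halfplane H \<longleftrightarrow> (\<exists>a b. a \<noteq> 0 \<and> H = {x. inner a x \<le> b})"

definition general_position :: "(real^2) set \<Rightarrow> bool" where
  "general_position P \<longleftrightarrow>
     (\<forall>x\<in>P. \<forall>y\<in>P. \<forall>z\<in>P. x \<noteq> y \<and> y \<noteq> z \<and> x \<noteq> z \<longrightarrow> \<not> collinear {x, y, z})"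

end

theory Submission
  imports Defs
begin

text \<open>
  Call a closed halfplane a majority if it contains at least \<open>k = \<lfloor>n/2\<rfloor> + 1\<close> points. Suppose the
  nonzero normal directions are covered by three arcs, each shorter than \<open>\<pi>\<close>, such that two majorities
  with normals in the same arc always share at least \<open>n/6\<close> points. Then, by Helly's theorem and
  compactness, each arc has a point lying in all majorities with normal in this arc and in all
  halfplanes with more than \<open>5n/6\<close> points; these three points are as desired.

  To find the arcs, fix a generic direction \<open>u\<close> and a majority \<open>U\<close> of exactly \<open>k\<close> points with normal
  \<open>u\<close>. Turn away from \<open>u\<close> on either side until a majority shares fewer than \<open>m\<close> points with \<open>U\<close>;
  this gives two arcs. The number of points common to two minimal majorities decreases with
  their angle, so these two arcs are good, and for the third arc it is enough to look at its
  extreme majorities \<open>V\<close> and \<open>W\<close>. Since \<open>|U \<inter> V|\<close> and \<open>|U \<inter> W|\<close> are less than \<open>m\<close>, counting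
  \<open>U \<union> V \<union> W\<close> gives \<open>|V \<inter> W| \<ge> 3k - n - 2(m - 1)\<close>, which is at least \<open>m\<close> for a suitable
  \<open>m \<ge> n/6\<close>.
\<close>

section \<open>Halfplanes given by a normal and a threshold; families of normals\<close>

definition hp :: "'a::real_inner \<Rightarrow> real \<Rightarrow> 'a set" where
  "hp a s = {x. s \<le> inner a x}"

text \<open>A weak form of lying in an open half circle. Helly's theorem in the plane asks about
  three sets at a time only, and half-open half circles satisfy this form as well.\<close>

definition acute_triples :: "'a::real_inner set \<Rightarrow> bool" where
  "acute_triples A \<longleftrightarrow>
     (\<forall>a\<in>A. \<forall>b\<in>A. \<forall>c\<in>A. \<exists>v. 0 < inner a v \<and> 0 < inner b v \<and> 0 < inner c v)"

definition clustered :: "'a::real_inner set \<Rightarrow> nat \<Rightarrow> nat \<Rightarrow> 'a set \<Rightarrow> bool" where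
  "clustered P k m A \<longleftrightarrow>
     (\<forall>a\<in>A. \<forall>b\<in>A. \<forall>s t. k \<le> card (P \<inter> hp a s) \<longrightarrow> k \<le> card (P \<inter> hp b t) \<longrightarrow>
        m \<le> card (P \<inter> hp a s \<inter> hp b t))"

section \<open>Piercing points from Helly's theorem\<close>

lemma card_Int_Int_ge:
  assumes "finite P"
  shows "card (P \<inter> X) + card (P \<inter> Y) \<le> card P + card (P \<inter> X \<inter> Y)"
proof -
  have "card (P \<inter> X) + card (P \<inter> Y) = card (P \<inter> X \<union> P \<inter> Y) + card (P \<inter> X \<inter> (P \<inter> Y))"
    using assms by (intro card_Un_Int) auto
  moreover have "card (P \<inter> X \<union> P \<inter> Y) \<le> card P"
    using assms by (intro card_mono) auto
  moreover have "P \<inter> X \<inter> (P \<inter> Y) = P \<inter> X \<inter> Y" by auto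
  ultimately show ?thesis by simp
qed

text \<open>Since \<open>three\<close> allows repeated sets, it also settles families with fewer
  than three members.\<close>

lemma helly_plane:
  fixes F :: "(real^2) set set"
  assumes fin: "finite F" and conv: "\<And>X. X \<in> F \<Longrightarrow> convex X"
    and three: "\<And>X Y Z. X \<in> F \<Longrightarrow> Y \<in> F \<Longrightarrow> Z \<in> F \<Longrightarrow> X \<inter> Y \<inter> Z \<noteq> {}"
  shows "\<Inter>F \<noteq> {}"
proof (cases "card F \<ge> 3")
  case True
  show ?thesis
  proof (rule Helly)
    show "DIM(real^2) + 1 \<le> card F" using True by simp
    show "\<forall>s\<in>F. convex s" using conv by blast
    fix t assume t: "t \<subseteq> F" "card t = DIM(real^2) + 1"
    then have "card t = 3" by simp
    then obtain X Y Z where "t = {X, Y, Z}" by (auto simp: card_3_iff)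
    then show "\<Inter>t \<noteq> {}" using three[of X Y Z] t(1) by auto
  qed
next
  case False
  then consider "card F = 0" | "card F = 1" | "card F = 2" by linarith
  then show ?thesis
  proof cases
    case 1 then show ?thesis using fin by simp
  next
    case 2
    then obtain X where "F = {X}" by (auto simp: card_1_singleton_iff)
    then show ?thesis using three[of X X X] by auto
  next
    case 3
    then obtain X Y where "F = {X, Y}" by (auto simp: card_2_iff)
    then show ?thesis using three[of X Y Y] by auto
  qed
qed

lemma hp_far_point:
  assumes "0 < inner a v"
  shows "\<forall>\<^sub>F r in at_top. r *\<^sub>R v \<in> hp a s"
  using eventually_ge_at_top[of "s / inner a v"]
  by eventually_elim (use assms in \<open>simp add: hp_def field_simps\<close>)

text \<open>Every three of the sets meet. Three majorities share a point far out along the vector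
  given by \<open>acute\<close>. Otherwise count: two majorities share at least n/6 points, one has
  more than n/2, and each \<open>big\<close> set misses fewer than n/6, so a point of
  \<open>P\<close> always survives.\<close>

lemma piercing_point:
  fixes P :: "(real^2) set"
  assumes fin: "finite P" and ne: "P \<noteq> {}" and k: "card P < 2 * k" and m: "card P \<le> 6 * m"
    and acute: "acute_triples A" and clus: "clustered P k m A"
  obtains p where "\<And>a s. 5 * card P < 6 * card (P \<inter> hp a s) \<Longrightarrow> p \<in> hp a s"
    and "\<And>a s. a \<in> A \<Longrightarrow> k \<le> card (P \<inter> hp a s) \<Longrightarrow> p \<in> hp a s"
proof -
  define N where "N = card P"
  have N: "0 < N" using fin ne by (simp add: N_def card_gt_0_iff)
  define FA where "FA = {hp a s | a s. a \<in> A \<and> k \<le> card (P \<inter> hp a s)}"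
  define FB where "FB = {hp a s | a s. 5 * N < 6 * card (P \<inter> hp a s)}"
  \<comment> \<open>The hull supplies the compactness needed for an infinite family. It contains
    \<open>P\<close>, hence is itself \<open>big\<close> and can join the family in Helly's
    theorem.\<close>
  define S where "S = convex hull P"
  define big where "big = (\<lambda>X. 5 * N < 6 * card (P \<inter> X))"
  have "P \<subseteq> S" by (simp add: S_def hull_subset)
  then have "P \<inter> S = P" by blast
  then have bigS: "big S" using N by (simp add: big_def N_def)
  have big_FB: "big X" if "X \<in> FB" for X using that by (auto simp: FB_def big_def)
  have FA_card: "N < 2 * card (P \<inter> X)" if "X \<in> FA" for X
    using that k by (auto simp: FA_def N_def)
  have FA_FA: "m \<le> card (P \<inter> X \<inter> Y)" if "X \<in> FA" "Y \<in> FA" for X Y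
    using that clus unfolding FA_def clustered_def by blast
  have int: "card (P \<inter> X) + card (P \<inter> Y) \<le> N + card (P \<inter> X \<inter> Y)" for X Y
    using card_Int_Int_ge[OF fin] by (simp add: N_def)
  have int3: "card (P \<inter> X \<inter> Y) + card (P \<inter> Z) \<le> N + card (P \<inter> X \<inter> Y \<inter> Z)" for X Y Z
    using int[of "X \<inter> Y" Z] by (simp add: Int_assoc)
  have nonempty: "X \<inter> Y \<inter> Z \<noteq> {}" if "0 < card (P \<inter> X \<inter> Y \<inter> Z)" for X Y Z
    using that by (auto simp: card_gt_0_iff)
  have AAB: "X \<inter> Y \<inter> Z \<noteq> {}" if "X \<in> FA" "Y \<in> FA" "big Z" for X Y Z
    by (rule nonempty) (use FA_FA[OF that(1,2)] that(3) int3[of X Y Z] m in \<open>simp add: big_def N_def\<close>)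
  have ABB: "X \<inter> Y \<inter> Z \<noteq> {}" if "X \<in> FA" "big Y" "big Z" for X Y Z
    by (rule nonempty) (use FA_card[OF that(1)] that(2,3) int3[of X Y Z] int[of X Y] in \<open>simp add: big_def\<close>)
  have BBB: "X \<inter> Y \<inter> Z \<noteq> {}" if "big X" "big Y" "big Z" for X Y Z
    by (rule nonempty) (use that int3[of X Y Z] int[of X Y] N in \<open>simp add: big_def\<close>)
  have AAA: "X \<inter> Y \<inter> Z \<noteq> {}" if XYZ: "X \<in> FA" "Y \<in> FA" "Z \<in> FA" for X Y Z
  proof -
    from XYZ obtain a s b t c r where X: "X = hp a s" "a \<in> A" and Y: "Y = hp b t" "b \<in> A"
      and Z: "Z = hp c r" "c \<in> A" by (auto simp: FA_def)
    from acute X Y Z obtain v where "0 < inner a v" "0 < inner b v" "0 < inner c v"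
      unfolding acute_triples_def by blast
    then have "\<forall>\<^sub>F q in at_top. q *\<^sub>R v \<in> hp a s \<and> q *\<^sub>R v \<in> hp b t \<and> q *\<^sub>R v \<in> hp c r"
      by (intro eventually_conj hp_far_point)
    from eventually_happens[OF this] show ?thesis using X Y Z by auto
  qed
  have triple: "X \<inter> Y \<inter> Z \<noteq> {}"
    if "X \<in> FA \<or> big X" "Y \<in> FA \<or> big Y" "Z \<in> FA \<or> big Z" for X Y Z
    using that AAA[of X Y Z] AAB[of X Y Z] AAB[of X Z Y] AAB[of Y Z X]
      ABB[of X Y Z] ABB[of Y X Z] ABB[of Z X Y] BBB[of X Y Z]
    by (elim disjE) (simp_all add: Int_ac)
  have convF: "convex X" "closed X" if "X \<in> FA \<union> FB" for X
    using that by (auto simp: FA_def FB_def hp_def convex_halfspace_ge closed_halfspace_ge)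
  have "S \<inter> \<Inter>(FA \<union> FB) \<noteq> {}"
  proof (rule compact_imp_fip)
    show "compact S" by (simp add: S_def fin finite_imp_compact_convex_hull)
    show "closed T" if "T \<in> FA \<union> FB" for T using convF that by blast
    fix F' assume F': "finite F'" "F' \<subseteq> FA \<union> FB"
    have "\<Inter>(insert S F') \<noteq> {}"
    proof (rule helly_plane)
      show "finite (insert S F')" using F' by simp
      show "convex X" if "X \<in> insert S F'" for X
        using that F' convF by (auto simp: S_def)
      show "X \<inter> Y \<inter> Z \<noteq> {}" if "X \<in> insert S F'" "Y \<in> insert S F'" "Z \<in> insert S F'" for X Y Z
        by (rule triple) (use that F' bigS big_FB in blast)+
    qed
    then show "S \<inter> \<Inter>F' \<noteq> {}" by simp
  qed
  then obtain p where "p \<in> \<Inter>(FA \<union> FB)" by blast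
  then show ?thesis
    by (intro that[of p]) (unfold FA_def FB_def N_def, blast+)
qed

section \<open>How overlaps change as normals turn\<close>

text \<open>Of three halfplanes with normals in cyclic order, either the outer two meet inside the
  middle one, or their complements meet inside the complement of the middle one.\<close>

lemma card_hp_Int_mono:
  assumes fin: "finite P" and st: "0 \<le> s" "0 \<le> t"
    and le: "card (P \<inter> hp u a) \<le> card (P \<inter> hp (s *\<^sub>R u + t *\<^sub>R w) b)"
  shows "card (P \<inter> hp u a \<inter> hp w c) \<le> card (P \<inter> hp (s *\<^sub>R u + t *\<^sub>R w) b \<inter> hp w c)"
\<comment> \<open>The right-hand side is the value of the middle functional at any point lying on
  both outer boundary lines.\<close>
proof (cases "b \<le> s * a + t * c")
  case True
  have "hp u a \<inter> hp w c \<subseteq> hp (s *\<^sub>R u + t *\<^sub>R w) b"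
  proof
    fix x assume x: "x \<in> hp u a \<inter> hp w c"
    then have "s * a + t * c \<le> s * inner u x + t * inner w x"
      by (intro add_mono mult_left_mono) (use st in \<open>auto simp: hp_def\<close>)
    then show "x \<in> hp (s *\<^sub>R u + t *\<^sub>R w) b" using True by (simp add: hp_def inner_add_left)
  qed
  then show ?thesis by (intro card_mono) (use fin in auto)
next
  case False
  let ?U = "hp u a" and ?B = "hp (s *\<^sub>R u + t *\<^sub>R w) b" and ?W = "hp w c"
  have sub: "?B - ?W \<subseteq> ?U"
  proof (rule ccontr)
    assume "\<not> ?B - ?W \<subseteq> ?U"
    then obtain x where x: "b \<le> s * inner u x + t * inner w x" "inner w x < c" "inner u x < a"
      by (force simp: hp_def inner_add_left)
    then have "s * inner u x + t * inner w x \<le> s * a + t * c"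
      by (intro add_mono mult_left_mono) (use st in auto)
    then show False using x False by linarith
  qed
  have split: "card (P \<inter> X) = card (P \<inter> X \<inter> ?W) + card (P \<inter> X - ?W)" for X
    using fin by (subst card_Un_disjoint[symmetric]) (auto intro: arg_cong[where f=card])
  \<comment> \<open>Outside \<open>?W\<close> the middle halfplane has no more points than
    \<open>?U\<close>, but in total it has at least as many; the surplus must lie inside
    \<open>?W\<close>.\<close>
  have "card (P \<inter> ?B - ?W) \<le> card (P \<inter> ?U - ?W)"
    by (rule card_mono) (use fin sub in auto)
  then show ?thesis using le split[of ?U] split[of ?B] by linarith
qed

text \<open>The determinant inequality says that the first vector is at no larger angle from
  \<open>u\<close> than the second, which puts it in the cone of \<open>u\<close> and the second.
  Negative \<open>x1\<close> and \<open>x2\<close> are allowed, so the whole upper half plane is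
  covered.\<close>

lemma cone_order:
  fixes u w :: "'a::real_vector"
  assumes "0 \<le> y1" "0 \<le> y2" "0 < y2 \<or> 0 < x2" "0 < y1 \<or> 0 < x1" "x2 * y1 \<le> x1 * y2"
  obtains c d where "0 \<le> c" "0 \<le> d"
    "x1 *\<^sub>R u + y1 *\<^sub>R w = c *\<^sub>R u + d *\<^sub>R (x2 *\<^sub>R u + y2 *\<^sub>R w)"
proof (cases "0 < y2")
  case True
  show ?thesis
  proof (rule that)
    show "0 \<le> x1 - x2 * y1 / y2" using True assms by (simp add: field_simps)
    show "0 \<le> y1 / y2" using True assms by simp
    have "d * y2 = y1" if "d = y1 / y2" for d using True that by simp
    then show "x1 *\<^sub>R u + y1 *\<^sub>R w = (x1 - x2 * y1 / y2) *\<^sub>R u + (y1 / y2) *\<^sub>R (x2 *\<^sub>R u + y2 *\<^sub>R w)"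
      by (simp add: algebra_simps)
  qed
next
  case False
  then have "y2 = 0" "0 < x2" using assms by auto
  then have "y1 = 0" using assms by (simp add: mult_le_0_iff)
  show ?thesis by (rule that[of x1 0]) (use assms \<open>y1 = 0\<close> in auto)
qed

text \<open>The outer normals move inwards one at a time: if \<open>b1\<close> is the one nearer to
  \<open>u\<close>, first \<open>w\<close> is replaced by \<open>b2\<close>, then \<open>u\<close>
  by \<open>b1\<close>, which lies between \<open>u\<close> and \<open>b2\<close>. Neither move
  decreases the overlap.\<close>

lemma card_hp_Int_cone:
  assumes fin: "finite P"
    and nonneg: "0 \<le> s1" "0 \<le> r1" "0 \<le> s2" "0 \<le> r2" "0 < s1 + r1" "0 < s2 + r2"
    and b1: "b1 = s1 *\<^sub>R u + r1 *\<^sub>R w" and b2: "b2 = s2 *\<^sub>R u + r2 *\<^sub>R w"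
    and k: "card (P \<inter> hp u a) \<le> k" "card (P \<inter> hp w c) \<le> k"
    and k1: "k \<le> card (P \<inter> hp b1 d1)" and k2: "k \<le> card (P \<inter> hp b2 d2)"
  shows "card (P \<inter> hp u a \<inter> hp w c) \<le> card (P \<inter> hp b1 d1 \<inter> hp b2 d2)"
proof -
  have *: "card (P \<inter> hp u a \<inter> hp w c) \<le> card (P \<inter> hp b1 d1 \<inter> hp b2 d2)"
    if nonneg: "0 \<le> s1" "0 \<le> r1" "0 \<le> s2" "0 \<le> r2" "0 < s1 + r1" "0 < s2 + r2"
      and b1: "b1 = s1 *\<^sub>R u + r1 *\<^sub>R w" and b2: "b2 = s2 *\<^sub>R u + r2 *\<^sub>R w"
      and k1: "k \<le> card (P \<inter> hp b1 d1)" and k2: "k \<le> card (P \<inter> hp b2 d2)"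
      and ord: "s2 * r1 \<le> s1 * r2" for s1 r1 s2 r2 b1 b2 d1 d2
  proof -
    have "0 < r2 \<or> 0 < s2" "0 < r1 \<or> 0 < s1" using nonneg by linarith+
    then obtain e f where ef: "0 \<le> e" "0 \<le> f" "b1 = e *\<^sub>R u + f *\<^sub>R b2"
      using cone_order[of r1 r2 s2 s1 u w] nonneg ord b1 b2 by metis
    have "card (P \<inter> hp u a \<inter> hp w c) = card (P \<inter> hp w c \<inter> hp u a)" by (simp add: Int_ac)
    also have "\<dots> \<le> card (P \<inter> hp b2 d2 \<inter> hp u a)"
      using card_hp_Int_mono[OF fin nonneg(4,3), of w c u d2 a] k k2 b2 by (simp add: add.commute)
    also have "\<dots> = card (P \<inter> hp u a \<inter> hp b2 d2)" by (simp add: Int_ac)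
    also have "\<dots> \<le> card (P \<inter> hp b1 d1 \<inter> hp b2 d2)"
      using card_hp_Int_mono[OF fin ef(1,2), of u a b2 d1 d2] k k1 ef by simp
    finally show ?thesis .
  qed
  show ?thesis
  proof (cases "s2 * r1 \<le> s1 * r2")
    case True
    then show ?thesis by (intro *[OF nonneg b1 b2 k1 k2])
  next
    case False
    then have "card (P \<inter> hp u a \<inter> hp w c) \<le> card (P \<inter> hp b2 d2 \<inter> hp b1 d1)"
      by (intro *[OF nonneg(3,4,1,2,6,5) b2 b1 k2 k1]) simp
    then show ?thesis by (simp add: Int_ac)
  qed
qed

section \<open>Halfplanes with exactly \<open>k\<close> points, and removal of ties by
  tilting\<close>

lemma exists_upper_set_of_card:
  fixes X :: "real set"
  assumes "finite X" "k \<le> card X"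
  shows "\<exists>c. card {x \<in> X. c \<le> x} = k"
  using assms(2)
proof (induction k)
  case 0
  obtain c where "\<forall>x\<in>X. x < c"
    using bdd_above_finite[OF assms(1)] by (metis bdd_above_def gt_ex order_le_less_trans)
  then have "{x \<in> X. c \<le> x} = {}" by force
  then show ?case by (metis card.empty)
next
  case (Suc k)
  then obtain c where c: "card {x \<in> X. c \<le> x} = k" by auto
  define L where "L = {x \<in> X. x < c}"
  have "L \<noteq> {}"
  proof
    assume "L = {}"
    then have "{x \<in> X. c \<le> x} = X" by (force simp: L_def)
    then show False using c Suc by simp
  qed
  moreover have "finite L" using assms by (simp add: L_def)
  ultimately have M: "Max L \<in> L" "\<And>x. x \<in> L \<Longrightarrow> x \<le> Max L" by auto
  have "{x \<in> X. Max L \<le> x} = insert (Max L) {x \<in> X. c \<le> x}"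
    using M by (force simp: L_def)
  moreover have "Max L \<notin> {x \<in> X. c \<le> x}" using M by (auto simp: L_def)
  ultimately have "card {x \<in> X. Max L \<le> x} = Suc k" using assms c by simp
  then show ?case by blast
qed

text \<open>Without ties in direction \<open>u\<close>, lowering the threshold picks up one point at
  a time.\<close>

lemma exists_hp_of_card:
  assumes "finite P" "k \<le> card P" and inj: "inj_on (inner u) P"
  obtains c where "card (P \<inter> hp u c) = k"
proof -
  have "k \<le> card (inner u ` P)" using assms by (simp add: card_image)
  then obtain c where c: "card {x \<in> inner u ` P. c \<le> x} = k"
    using exists_upper_set_of_card assms(1) by blast
  have "inner u ` (P \<inter> hp u c) = {x \<in> inner u ` P. c \<le> x}" by (auto simp: hp_def)
  then have "card (P \<inter> hp u c) = k"
    using c card_image[OF inj_on_subset[OF inj, of "P \<inter> hp u c"]] by auto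
  then show ?thesis using that by blast
qed

text \<open>Lexicographic positivity of \<open>(y, x)\<close> is positivity under all small
  perturbations; the half-open arcs below are defined by this condition.\<close>

lemma eventually_add_mult_pos:
  fixes x y :: real
  assumes "0 < y \<or> (y = 0 \<and> 0 < x)"
  shows "\<forall>\<^sub>F e in at_right 0. 0 < y + e * x"
proof (cases "y = 0")
  case True
  show ?thesis
    using eventually_at_right_less[of "0::real"]
    by eventually_elim (use True assms in simp)
next
  case False
  have "((\<lambda>e. y + e * x) \<longlongrightarrow> y + 0 * x) (at_right 0)" by (intro tendsto_intros)
  then show ?thesis using False assms by (intro order_tendstoD) auto
qed

text \<open>By \<open>sep\<close>, no difference of two distinct points is orthogonal to both
  \<open>b\<close> and \<open>u\<close>, so each pair is separated for all small \<open>e\<close>;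
  there are finitely many pairs.\<close>

lemma eventually_inj_on_inner:
  assumes fin: "finite P" and sep: "\<And>d. inner b d = 0 \<Longrightarrow> inner u d = 0 \<Longrightarrow> d = 0"
  shows "\<forall>\<^sub>F e in at_right (0::real). inj_on (inner (b + e *\<^sub>R u)) P"
proof -
  have "\<forall>\<^sub>F e in at_right 0. inner (b + e *\<^sub>R u) p \<noteq> inner (b + e *\<^sub>R u) q" if "p \<noteq> q" for p q
  proof -
    define y x where "y = inner b (p - q)" and "x = inner u (p - q)"
    have "y \<noteq> 0 \<or> x \<noteq> 0" using sep[of "p - q"] that by (auto simp: y_def x_def)
    then have "(0 < y \<or> (y = 0 \<and> 0 < x)) \<or> (0 < - y \<or> (- y = 0 \<and> 0 < - x))" by linarith
    then have "\<forall>\<^sub>F e in at_right 0. y + e * x \<noteq> 0"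
    proof
      assume "0 < y \<or> (y = 0 \<and> 0 < x)"
      from eventually_add_mult_pos[OF this] show ?thesis by eventually_elim simp
    next
      assume "0 < - y \<or> (- y = 0 \<and> 0 < - x)"
      from eventually_add_mult_pos[OF this] show ?thesis by eventually_elim auto
    qed
    then show ?thesis
      by eventually_elim (simp add: y_def x_def algebra_simps)
  qed
  then have "\<forall>\<^sub>F e in at_right 0. \<forall>p\<in>P. \<forall>q\<in>P. p \<noteq> q \<longrightarrow> inner (b + e *\<^sub>R u) p \<noteq> inner (b + e *\<^sub>R u) q"
    by (intro eventually_ball_finite[OF fin] ballI) (simp add: eventually_mono)
  then show ?thesis by eventually_elim (auto simp: inj_on_def)
qed

text \<open>Ties in direction \<open>b\<close> may rule out a halfplane with exactly
  \<open>k\<close> points. A slight tilt towards \<open>u\<close> breaks them and keeps points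
  inside \<open>hp b s\<close> ahead of those outside, so the first \<open>k\<close> points in the
  tilted direction come from \<open>hp b s\<close>.\<close>

lemma perturbed_hp:
  assumes fin: "finite P" and sep: "\<And>d. inner b d = 0 \<Longrightarrow> inner u d = 0 \<Longrightarrow> d = 0"
    and k: "k \<le> card (P \<inter> hp b s)"
  obtains e c where "0 < e" "card (P \<inter> hp (b + e *\<^sub>R u) c) = k"
    "P \<inter> hp (b + e *\<^sub>R u) c \<subseteq> hp b s"
proof -
  have "\<forall>\<^sub>F e in at_right 0. \<forall>p\<in>P \<inter> hp b s. \<forall>q\<in>P - hp b s. inner (b + e *\<^sub>R u) q < inner (b + e *\<^sub>R u) p"
  proof (intro eventually_ball_finite ballI)
    fix p q assume "p \<in> P \<inter> hp b s" "q \<in> P - hp b s"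
    then have "0 < inner b (p - q)" by (auto simp: hp_def inner_diff_right)
    then show "\<forall>\<^sub>F e in at_right 0. inner (b + e *\<^sub>R u) q < inner (b + e *\<^sub>R u) p"
      using eventually_add_mult_pos[of "inner b (p - q)" "inner u (p - q)"]
      by (auto elim!: eventually_mono simp: algebra_simps)
  qed (use fin in auto)
  then have "\<forall>\<^sub>F e in at_right 0. (\<forall>p\<in>P \<inter> hp b s. \<forall>q\<in>P - hp b s. inner (b + e *\<^sub>R u) q < inner (b + e *\<^sub>R u) p)
      \<and> inj_on (inner (b + e *\<^sub>R u)) P \<and> 0 < e"
    by (intro eventually_conj eventually_inj_on_inner fin sep eventually_at_right_less)
  then obtain e where e: "0 < e" "inj_on (inner (b + e *\<^sub>R u)) P"
    and sepe: "\<And>p q. p \<in> P \<inter> hp b s \<Longrightarrow> q \<in> P - hp b s \<Longrightarrow> inner (b + e *\<^sub>R u) q < inner (b + e *\<^sub>R u) p"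
    using eventually_happens'[OF trivial_limit_at_right_real] by blast
  have "k \<le> card P" using k card_mono[OF fin, of "P \<inter> hp b s"] by simp
  then obtain c where c: "card (P \<inter> hp (b + e *\<^sub>R u) c) = k"
    using exists_hp_of_card fin e(2) by blast
  have "P \<inter> hp (b + e *\<^sub>R u) c \<subseteq> hp b s"
  proof (rule ccontr)
    assume "\<not> ?thesis"
    then obtain q where q: "q \<in> P - hp b s" "q \<in> hp (b + e *\<^sub>R u) c" by blast
    have "P \<inter> hp b s \<subseteq> hp (b + e *\<^sub>R u) c"
      using sepe[OF _ q(1)] q(2) unfolding hp_def by fastforce
    then have "insert q (P \<inter> hp b s) \<subseteq> P \<inter> hp (b + e *\<^sub>R u) c" using q by blast
    then have "card (insert q (P \<inter> hp b s)) \<le> k"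
      unfolding c[symmetric] by (intro card_mono) (use fin in auto)
    then show False using q k fin by simp
  qed
  then show ?thesis using that e c by blast
qed

section \<open>From three families of normals to the three points\<close>

lemma clustered_one:
  assumes "finite P" "card P < 2 * k"
  shows "clustered P k 1 A"
  unfolding clustered_def
proof (intro ballI allI impI)
  fix a b s t assume "k \<le> card (P \<inter> hp a s)" "k \<le> card (P \<inter> hp b t)"
  then show "1 \<le> card (P \<inter> hp a s \<inter> hp b t)"
    using card_Int_Int_ge[OF assms(1), of "hp a s" "hp b t"] assms(2) by linarith
qed

text \<open>Each family yields one point. A halfplane with fewer than n/6 points leaves more than
  5n/6 outside and so avoids all three; one with fewer than n/2 leaves a majority outside, whose
  normal is in some family, and so avoids that family's point.\<close>

lemma halfplane_points_from_cover:
  fixes P :: "(real^2) set"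
  assumes fin: "finite P" and ne: "P \<noteq> {}" and k: "k = card P div 2 + 1" and m: "card P \<le> 6 * m"
    and A: "acute_triples A1" "acute_triples A2" "acute_triples A3"
      "clustered P k m A1" "clustered P k m A2" "clustered P k m A3"
    and cover: "\<And>a. a \<noteq> 0 \<Longrightarrow> a \<in> A1 \<union> A2 \<union> A3"
  shows "\<exists>p1 p2 p3 :: real^2.
           (\<forall>H. closed_halfplane H \<and> (p1 \<in> H \<or> p2 \<in> H \<or> p3 \<in> H)
                 \<longrightarrow> real (card (P \<inter> H)) \<ge> real (card P) / 6) \<and>
           (\<forall>H. closed_halfplane H \<and> p1 \<in> H \<and> p2 \<in> H \<and> p3 \<in> H
                 \<longrightarrow> real (card (P \<inter> H)) \<ge> real (card P) / 2)"
proof -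
  have k2: "card P < 2 * k" using k by simp
  note pierce = piercing_point[OF fin ne k2 m]
  obtain p1 where p1: "\<And>a s. 5 * card P < 6 * card (P \<inter> hp a s) \<Longrightarrow> p1 \<in> hp a s"
    "\<And>a s. a \<in> A1 \<Longrightarrow> k \<le> card (P \<inter> hp a s) \<Longrightarrow> p1 \<in> hp a s"
    using pierce[OF A(1,4)] by metis
  obtain p2 where p2: "\<And>a s. 5 * card P < 6 * card (P \<inter> hp a s) \<Longrightarrow> p2 \<in> hp a s"
    "\<And>a s. a \<in> A2 \<Longrightarrow> k \<le> card (P \<inter> hp a s) \<Longrightarrow> p2 \<in> hp a s"
    using pierce[OF A(2,5)] by metis
  obtain p3 where p3: "\<And>a s. 5 * card P < 6 * card (P \<inter> hp a s) \<Longrightarrow> p3 \<in> hp a s"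
    "\<And>a s. a \<in> A3 \<Longrightarrow> k \<le> card (P \<inter> hp a s) \<Longrightarrow> p3 \<in> hp a s"
    using pierce[OF A(3,6)] by metis
  \<comment> \<open>The complement of \<open>H\<close> is open; moving its boundary to the nearest
    point of \<open>P\<close> outside \<open>H\<close> gives a closed halfplane with the same points
    of \<open>P\<close>.\<close>
  have compl: "\<exists>s. (\<forall>x\<in>hp a s. x \<notin> H) \<and> card (P \<inter> hp a s) = card P - card (P \<inter> H)"
    if H: "H = {x. inner a x \<le> b}" and less: "card (P \<inter> H) < card P" for H a b
  proof -
    define s where "s = Min (inner a ` (P - H))"
    have "P - H \<noteq> {}"
    proof
      assume "P - H = {}"
      then have "P \<inter> H = P" by blast
      then show False using less by simp
    qed
    then have s: "s \<in> inner a ` (P - H)" "\<And>x. x \<in> P - H \<Longrightarrow> s \<le> inner a x"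
      using fin by (auto simp: s_def)
    then have "b < s" using H by auto
    then have "P \<inter> hp a s = P - P \<inter> H" using s(2) H by (auto simp: hp_def)
    then have "card (P \<inter> hp a s) = card P - card (P \<inter> H)"
      using fin by (simp add: card_Diff_subset)
    moreover have "\<forall>x\<in>hp a s. x \<notin> H" using \<open>b < s\<close> H by (auto simp: hp_def)
    ultimately show ?thesis by blast
  qed
  have N: "0 < card P" using fin ne by (simp add: card_gt_0_iff)
  show ?thesis
  proof (intro exI conjI allI impI)
    fix H :: "(real^2) set"
    assume asm: "closed_halfplane H \<and> (p1 \<in> H \<or> p2 \<in> H \<or> p3 \<in> H)"
    show "real (card (P \<inter> H)) \<ge> real (card P) / 6"
    proof (rule ccontr)
      assume "\<not> ?thesis"
      then have lt: "6 * card (P \<inter> H) < card P" by linarith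
      obtain a b where H: "H = {x. inner a x \<le> b}" using asm unfolding closed_halfplane_def by blast
      obtain s where s: "\<forall>x\<in>hp a s. x \<notin> H" "card (P \<inter> hp a s) = card P - card (P \<inter> H)"
        using compl[OF H] lt by auto
      have "5 * card P < 6 * card (P \<inter> hp a s)" using s(2) lt by linarith
      then show False using p1(1) p2(1) p3(1) s(1) asm by blast
    qed
  next
    fix H :: "(real^2) set"
    assume asm: "closed_halfplane H \<and> p1 \<in> H \<and> p2 \<in> H \<and> p3 \<in> H"
    show "real (card (P \<inter> H)) \<ge> real (card P) / 2"
    proof (rule ccontr)
      assume "\<not> ?thesis"
      then have lt: "2 * card (P \<inter> H) < card P" by linarith
      obtain a b where H: "a \<noteq> 0" "H = {x. inner a x \<le> b}"
        using asm unfolding closed_halfplane_def by blast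
      obtain s where s: "\<forall>x\<in>hp a s. x \<notin> H" "card (P \<inter> hp a s) = card P - card (P \<inter> H)"
        using compl[OF H(2)] lt by auto
      have "k \<le> card (P \<inter> hp a s)" using s(2) lt k by linarith
      then show False using cover[OF H(1)] p1(2) p2(2) p3(2) s(1) asm by blast
    qed
  qed
qed

section \<open>Arcs of directions, described by slopes\<close>

text \<open>The half circle from \<open>u\<close>, included, through \<open>J\<close> to
  \<open>- u\<close>, excluded.\<close>

definition half_open_arc :: "'a::real_inner \<Rightarrow> 'a \<Rightarrow> 'a set" where
  "half_open_arc u J = {x *\<^sub>R u + y *\<^sub>R J | x y. 0 < y \<or> (y = 0 \<and> 0 < x)}"

text \<open>The closed arc from \<open>J + t1 *\<^sub>R u\<close> through \<open>- u\<close> to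
  \<open>- J + t2 *\<^sub>R u\<close>, split by the sign of \<open>y\<close>.\<close>

definition far_arc :: "'a::real_inner \<Rightarrow> 'a \<Rightarrow> real \<Rightarrow> real \<Rightarrow> 'a set" where
  "far_arc u J t1 t2 = {x *\<^sub>R u + y *\<^sub>R J | x y.
     (0 < y \<and> x \<le> y * t1) \<or> (y < 0 \<and> x \<le> - y * t2) \<or> (y = 0 \<and> x < 0)}"

text \<open>The direction of \<open>J + t u\<close> turns from \<open>- u\<close> towards \<open>u\<close> as \<open>t\<close> increases.\<close>

definition thin :: "'a::real_inner set \<Rightarrow> nat \<Rightarrow> nat \<Rightarrow> 'a \<Rightarrow> real \<Rightarrow> 'a \<Rightarrow> real set" where
  "thin P k m u c J = {t. \<exists>d. card (P \<inter> hp (J + t *\<^sub>R u) d) = k \<and>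
     card (P \<inter> hp u c \<inter> hp (J + t *\<^sub>R u) d) < m}"

text \<open>The directions from \<open>u\<close> on that come strictly before every thin one;
  quantifying over \<open>thin\<close> avoids a supremum that need not be attained.\<close>

definition near_arc :: "'a::real_inner set \<Rightarrow> nat \<Rightarrow> nat \<Rightarrow> 'a \<Rightarrow> real \<Rightarrow> 'a \<Rightarrow> 'a set" where
  "near_arc P k m u c J = {x *\<^sub>R u + y *\<^sub>R J | x y.
     (0 < y \<and> (\<forall>t\<in>thin P k m u c J. y * t < x)) \<or> (y = 0 \<and> 0 < x)}"

lemma acute_triples_subset: "acute_triples B \<Longrightarrow> A \<subseteq> B \<Longrightarrow> acute_triples A"
  unfolding acute_triples_def by blast

lemma near_arc_subset: "near_arc P k m u c J \<subseteq> half_open_arc u J"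
  unfolding near_arc_def half_open_arc_def by blast

lemma far_arc_mono: "t1 \<le> t1' \<Longrightarrow> t2 \<le> t2' \<Longrightarrow> far_arc u J t1 t2 \<subseteq> far_arc u J t1' t2'"
proof
  fix b assume t: "t1 \<le> t1'" "t2 \<le> t2'" and "b \<in> far_arc u J t1 t2"
  then obtain x y where b: "b = x *\<^sub>R u + y *\<^sub>R J"
    and xy: "(0 < y \<and> x \<le> y * t1) \<or> (y < 0 \<and> x \<le> - y * t2) \<or> (y = 0 \<and> x < 0)"
    unfolding far_arc_def by blast
  have "y * t1 \<le> y * t1'" if "0 < y" using that t by simp
  moreover have "- y * t2 \<le> - y * t2'" if "y < 0" using that t by simp
  ultimately have "(0 < y \<and> x \<le> y * t1') \<or> (y < 0 \<and> x \<le> - y * t2') \<or> (y = 0 \<and> x < 0)"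
    using xy by linarith
  then show "b \<in> far_arc u J t1' t2'" using b unfolding far_arc_def by blast
qed

section \<open>Acuteness, cones and the near arcs in an orthonormal frame\<close>

text \<open>Abstracting the frame lets one proof serve both sides of \<open>u\<close>, by exchanging
  \<open>J\<close> and \<open>- J\<close>, and also the opposite half circle.\<close>

locale orthonormal_frame =
  fixes u J :: "'a::real_inner"
  assumes uu: "inner u u = 1" and JJ: "inner J J = 1" and uJ: "inner u J = 0"
    and frame: "b = inner b u *\<^sub>R u + inner b J *\<^sub>R J"
begin

lemma Ju: "inner J u = 0"
  using uJ by (simp add: inner_commute)

lemma neg_J: "orthonormal_frame u (- J)"
  by unfold_locales (use uu JJ uJ frame in simp_all)

lemma neg: "orthonormal_frame (- u) (- J)"
  by unfold_locales (use uu JJ uJ frame in simp_all)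

text \<open>The witness is \<open>J + e *\<^sub>R u\<close> with small positive \<open>e\<close>. No
  single \<open>e\<close> works for the whole arc, but any three members share one.\<close>

lemma acute_half_open_arc: "acute_triples (half_open_arc u J)"
  unfolding acute_triples_def
proof (intro ballI)
  have ev: "\<forall>\<^sub>F e in at_right 0. 0 < inner a (J + e *\<^sub>R u)" if "a \<in> half_open_arc u J" for a
  proof -
    from that obtain x y where a: "a = x *\<^sub>R u + y *\<^sub>R J" and "0 < y \<or> (y = 0 \<and> 0 < x)"
      unfolding half_open_arc_def by blast
    from eventually_add_mult_pos[OF this(2)] show ?thesis
      by eventually_elim (simp add: a inner_add_left inner_add_right uu JJ uJ Ju)
  qed
  fix a b c assume "a \<in> half_open_arc u J" "b \<in> half_open_arc u J" "c \<in> half_open_arc u J"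
  then have "\<forall>\<^sub>F e in at_right 0. 0 < inner a (J + e *\<^sub>R u) \<and> 0 < inner b (J + e *\<^sub>R u) \<and> 0 < inner c (J + e *\<^sub>R u)"
    by (intro eventually_conj ev)
  then show "\<exists>v. 0 < inner a v \<and> 0 < inner b v \<and> 0 < inner c v"
    using eventually_happens'[OF trivial_limit_at_right_real] by blast
qed

text \<open>For \<open>r\<close> strictly between \<open>t1\<close> and \<open>- t2\<close>, the
  line spanned by \<open>J + r *\<^sub>R u\<close> misses the arc, and its normal
  \<open>r *\<^sub>R J - u\<close> is a common witness.\<close>

lemma acute_far_arc:
  assumes "t1 + t2 < 0"
  shows "acute_triples (far_arc u J t1 t2)"
proof -
  define r where "r = (t1 - t2) / 2"
  have r: "t1 < r" "t2 < - r" using assms by (auto simp: r_def field_simps)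
  have "0 < inner a (r *\<^sub>R J - u)" if "a \<in> far_arc u J t1 t2" for a
  proof -
    from that obtain x y where a: "a = x *\<^sub>R u + y *\<^sub>R J"
      and xy: "(0 < y \<and> x \<le> y * t1) \<or> (y < 0 \<and> x \<le> - y * t2) \<or> (y = 0 \<and> x < 0)"
      unfolding far_arc_def by blast
    have "y * t1 < y * r" if "0 < y" using that r by simp
    moreover have "- y * t2 < y * r" if "y < 0"
      using mult_strict_left_mono[OF r(2), of "- y"] that by simp
    ultimately have "x < y * r" using xy by (metis mult_zero_left order_le_less_trans)
    then show ?thesis
      by (simp add: a inner_add_left inner_diff_right uu JJ uJ Ju mult.commute)
  qed
  then show ?thesis unfolding acute_triples_def by blast
qed

lemma far_arc_cone:
  assumes neg: "t1 + t2 < 0" and b: "b \<in> far_arc u J t1 t2"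
  obtains s r where "0 \<le> s" "0 \<le> r" "0 < s + r"
    "b = s *\<^sub>R (J + t1 *\<^sub>R u) + r *\<^sub>R (- J + t2 *\<^sub>R u)"
proof -
  \<comment> \<open>The two ends of the arc add up to \<open>- D *\<^sub>R u\<close>, so adding
    \<open>e\<close> copies of both lowers \<open>x\<close> by \<open>e * D\<close> and keeps
    \<open>y\<close>.\<close>
  define D where "D = - (t1 + t2)"
  have D: "0 < D" using neg by (simp add: D_def)
  from b obtain x y where b: "b = x *\<^sub>R u + y *\<^sub>R J"
    and xy: "(0 < y \<and> x \<le> y * t1) \<or> (y < 0 \<and> x \<le> - y * t2) \<or> (y = 0 \<and> x < 0)"
    unfolding far_arc_def by blast
  note goal = that
  have *: thesis if "0 \<le> s" "0 \<le> r" "0 < s + r" "y = s - r" "x = s * t1 + r * t2" for s r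
    by (rule goal[of s r]) (use that b in \<open>auto simp: algebra_simps\<close>)
  from xy show thesis
  proof (elim disjE conjE)
    assume h: "0 < y" "x \<le> y * t1"
    define e where "e = (y * t1 - x) / D"
    have "e * D = y * t1 - x" "0 \<le> e" using D h by (auto simp: e_def)
    then show thesis by (intro *[of "y + e" e]) (use h in \<open>auto simp: D_def algebra_simps\<close>)
  next
    assume h: "y < 0" "x \<le> - y * t2"
    define e where "e = (- y * t2 - x) / D"
    have "e * D = - y * t2 - x" "0 \<le> e" using D h by (auto simp: e_def)
    then show thesis by (intro *[of e "e - y"]) (use h in \<open>auto simp: D_def algebra_simps\<close>)
  next
    assume h: "y = 0" "x < 0"
    define e where "e = - x / D"
    have "e * D = - x" "0 < e" using D h by (auto simp: e_def divide_neg_pos)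
    then show thesis by (intro *[of e e]) (use h in \<open>auto simp: D_def algebra_simps\<close>)
  qed
qed

lemma clustered_near_arc:
  assumes fin: "finite P" and base: "card (P \<inter> hp u c) = k" and "m \<le> k"
  shows "clustered P k m (near_arc P k m u c J)"
proof -
  have base_near: "m \<le> card (P \<inter> hp u c \<inter> hp b s)"
    if b: "b \<in> near_arc P k m u c J" and k: "k \<le> card (P \<inter> hp b s)" for b s
  proof -
    from b obtain x y where b: "b = x *\<^sub>R u + y *\<^sub>R J"
      and xy: "(0 < y \<and> (\<forall>t\<in>thin P k m u c J. y * t < x)) \<or> (y = 0 \<and> 0 < x)"
      unfolding near_arc_def by blast
    from xy show ?thesis
    proof (elim disjE conjE)
      assume y: "0 < y" and above: "\<forall>t\<in>thin P k m u c J. y * t < x"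
      have sep: "d = 0" if "inner b d = 0" "inner u d = 0" for d
      proof -
        have "inner J d = 0" using that y by (simp add: b inner_add_left)
        then show ?thesis using frame[of d] that by (simp add: inner_commute)
      qed
      \<comment> \<open>Tilting towards \<open>u\<close> only raises the slope, so the tilted
        direction is still beyond all thin slopes.\<close>
      obtain e d where e: "0 < e" and d: "card (P \<inter> hp (b + e *\<^sub>R u) d) = k"
        "P \<inter> hp (b + e *\<^sub>R u) d \<subseteq> hp b s"
        using perturbed_hp[OF fin sep k] by blast
      define t where "t = (x + e) / y"
      have scale: "hp (b + e *\<^sub>R u) d = hp (J + t *\<^sub>R u) (d / y)"
        using y by (auto simp: hp_def b t_def inner_add_left field_simps)
      have "t \<notin> thin P k m u c J" using above e y by (auto simp: t_def)
      then have "m \<le> card (P \<inter> hp u c \<inter> hp (b + e *\<^sub>R u) d)"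
        using d(1) unfolding thin_def scale by force
      also have "\<dots> \<le> card (P \<inter> hp u c \<inter> hp b s)"
        by (rule card_mono) (use fin d(2) in auto)
      finally show ?thesis .
    next
      assume "y = 0" "0 < x"
      then have scale: "hp b s = hp u (s / x)" by (auto simp: hp_def b field_simps)
      \<comment> \<open>Both normals are positive multiples of \<open>u\<close>: the halfplanes are
        nested, and the smaller one has at least \<open>k\<close> points.\<close>
      show ?thesis
      proof (cases "s / x \<le> c")
        case True
        then have "P \<inter> hp u c \<inter> hp b s = P \<inter> hp u c" unfolding scale by (auto simp: hp_def)
        then show ?thesis using base \<open>m \<le> k\<close> by simp
      next
        case False
        then have "P \<inter> hp u c \<inter> hp b s = P \<inter> hp b s" unfolding scale by (auto simp: hp_def)
        then show ?thesis using k \<open>m \<le> k\<close> by simp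
      qed
    qed
  qed
  \<comment> \<open>With \<open>b1\<close> between \<open>u\<close> and \<open>b2\<close>, turning
    \<open>u\<close> to \<open>b1\<close> does not decrease the overlap with the second halfplane,
    which reduces to \<open>base_near\<close>.\<close>
  have main: "m \<le> card (P \<inter> hp b1 s1 \<inter> hp b2 s2)"
    if "b1 = x1 *\<^sub>R u + y1 *\<^sub>R J" "b2 = x2 *\<^sub>R u + y2 *\<^sub>R J"
      "0 < y1 \<or> (y1 = 0 \<and> 0 < x1)" "0 < y2 \<or> (y2 = 0 \<and> 0 < x2)" "x2 * y1 \<le> x1 * y2"
      "b2 \<in> near_arc P k m u c J" "k \<le> card (P \<inter> hp b1 s1)" "k \<le> card (P \<inter> hp b2 s2)"
    for b1 b2 s1 s2 x1 x2 y1 y2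
  proof -
    have "0 \<le> y1" "0 \<le> y2" "0 < y2 \<or> 0 < x2" "0 < y1 \<or> 0 < x1" using that by auto
    then obtain e f where "0 \<le> e" "0 \<le> f"
      "x1 *\<^sub>R u + y1 *\<^sub>R J = e *\<^sub>R u + f *\<^sub>R (x2 *\<^sub>R u + y2 *\<^sub>R J)"
      using cone_order[OF _ _ _ _ \<open>x2 * y1 \<le> x1 * y2\<close>] by metis
    then have "0 \<le> e" "0 \<le> f" "b1 = e *\<^sub>R u + f *\<^sub>R b2" using that(1,2) by simp_all
    then have "card (P \<inter> hp u c \<inter> hp b2 s2) \<le> card (P \<inter> hp b1 s1 \<inter> hp b2 s2)"
      using card_hp_Int_mono[OF fin, of e f u c b2 s1 s2] base that by simp
    then show ?thesis using base_near[of b2 s2] that by linarith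
  qed
  show ?thesis
    unfolding clustered_def
  proof (intro ballI allI impI)
    fix b1 b2 s1 s2
    assume b: "b1 \<in> near_arc P k m u c J" "b2 \<in> near_arc P k m u c J"
      and k: "k \<le> card (P \<inter> hp b1 s1)" "k \<le> card (P \<inter> hp b2 s2)"
    obtain x1 y1 where 1: "b1 = x1 *\<^sub>R u + y1 *\<^sub>R J" "0 < y1 \<or> (y1 = 0 \<and> 0 < x1)"
      using b(1) unfolding near_arc_def by blast
    obtain x2 y2 where 2: "b2 = x2 *\<^sub>R u + y2 *\<^sub>R J" "0 < y2 \<or> (y2 = 0 \<and> 0 < x2)"
      using b(2) unfolding near_arc_def by blast
    show "m \<le> card (P \<inter> hp b1 s1 \<inter> hp b2 s2)"
    proof (cases "x2 * y1 \<le> x1 * y2")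
      case True
      then show ?thesis using main[OF 1(1) 2(1) 1(2) 2(2) _ b(2) k] by blast
    next
      case False
      then have "m \<le> card (P \<inter> hp b2 s2 \<inter> hp b1 s1)"
        using main[OF 2(1) 1(1) 2(2) 1(2) _ b(1) k(2,1)] by simp
      then show ?thesis by (simp add: Int_ac)
    qed
  qed
qed

end

section \<open>The far arc between thin directions\<close>

text \<open>Two opposite halfplanes with a common point cover the plane, so inclusion-exclusion is
  exact.\<close>

lemma card_antipodal_hp:
  assumes fin: "finite P" and k: "card P < 2 * k"
    and "card (P \<inter> hp a s) = k" "card (P \<inter> hp (- a) t) = k"
  shows "card (P \<inter> hp a s \<inter> hp (- a) t) + card P = 2 * k"
proof -
  have "0 < card (P \<inter> hp a s \<inter> hp (- a) t)"
    using card_Int_Int_ge[OF fin, of "hp a s" "hp (- a) t"] assms by linarith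
  then obtain x where "s \<le> inner a x" "t \<le> - inner a x"
    by (auto simp: card_gt_0_iff hp_def)
  then have "P \<inter> hp a s \<union> P \<inter> hp (- a) t = P" by (auto simp: hp_def)
  moreover have "P \<inter> hp a s \<inter> (P \<inter> hp (- a) t) = P \<inter> hp a s \<inter> hp (- a) t" by auto
  ultimately show ?thesis
    using card_Un_Int[of "P \<inter> hp a s" "P \<inter> hp (- a) t"] assms by simp
qed

lemma card_three_le:
  assumes fin: "finite P"
  shows "card (P \<inter> X) + card (P \<inter> Y) + card (P \<inter> Z)
    \<le> card P + card (P \<inter> X \<inter> Y) + card (P \<inter> X \<inter> Z) + card (P \<inter> Y \<inter> Z)"
proof -
  have "card (P \<inter> X) + card (P \<inter> Y) = card (P \<inter> (X \<union> Y)) + card (P \<inter> X \<inter> Y)"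
    using card_Un_Int[of "P \<inter> X" "P \<inter> Y"] fin by (simp add: Int_Un_distrib Int_ac Int_left_absorb)
  moreover have "card (P \<inter> (X \<union> Y)) + card (P \<inter> Z) \<le> card P + card (P \<inter> (X \<union> Y) \<inter> Z)"
    by (rule card_Int_Int_ge[OF fin])
  moreover have "card (P \<inter> (X \<union> Y) \<inter> Z) \<le> card (P \<inter> X \<inter> Z) + card (P \<inter> Y \<inter> Z)"
    using card_Un_le[of "P \<inter> X \<inter> Z" "P \<inter> Y \<inter> Z"] by (simp add: Int_Un_distrib Int_Un_distrib2)
  ultimately show ?thesis by linarith
qed

lemma thin_halfplanes:
  assumes fin: "finite P" and base: "card (P \<inter> hp u c) = k" and k: "card P < 2 * k"
    and m: "2 * k < card P + m" "3 * m + card P \<le> 3 * k + 2"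
    and t1: "t1 \<in> thin P k m u c J" and t2: "t2 \<in> thin P k m u c (- J)"
  obtains d1 d2 where "t1 + t2 < 0"
    "card (P \<inter> hp (J + t1 *\<^sub>R u) d1) = k" "card (P \<inter> hp (- J + t2 *\<^sub>R u) d2) = k"
    "m \<le> card (P \<inter> hp (J + t1 *\<^sub>R u) d1 \<inter> hp (- J + t2 *\<^sub>R u) d2)"
proof -
  define w1 w2 where "w1 = J + t1 *\<^sub>R u" and "w2 = - J + t2 *\<^sub>R u"
  obtain d1 where d1: "card (P \<inter> hp w1 d1) = k" "card (P \<inter> hp u c \<inter> hp w1 d1) < m"
    using t1 unfolding thin_def w1_def by blast
  obtain d2 where d2: "card (P \<inter> hp w2 d2) = k" "card (P \<inter> hp u c \<inter> hp w2 d2) < m"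
    using t2 unfolding thin_def w2_def by blast
  have f: "m \<le> card (P \<inter> hp w1 d1 \<inter> hp w2 d2)"
    using card_three_le[OF fin, of "hp u c" "hp w1 d1" "hp w2 d2"] base d1 d2 m by linarith
  have sum: "w1 + w2 = (t1 + t2) *\<^sub>R u" by (simp add: w1_def w2_def algebra_simps)
  have "t1 + t2 < 0"
  proof (rule ccontr)
    assume "\<not> ?thesis"
    \<comment> \<open>At sum zero the two halfplanes are antipodal and share only
      \<open>2 * k - card P\<close> points, fewer than \<open>m\<close>. At positive sum
      \<open>u\<close> lies between \<open>w1\<close> and \<open>w2\<close>, so the overlap is at
      most that of \<open>hp u c\<close> with \<open>hp w1 d1\<close>, again below
      \<open>m\<close>.\<close>
    then consider "t1 + t2 = 0" | "0 < t1 + t2" by linarith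
    then show False
    proof cases
      case 1
      then have "w2 = - w1" using sum by (simp add: eq_neg_iff_add_eq_0 add.commute)
      then show False using card_antipodal_hp[OF fin k d1(1), of d2] d2(1) f m by simp
    next
      case 2
      define e where "e = 1 / (t1 + t2)"
      have "u = e *\<^sub>R (w1 + w2)" using 2 unfolding sum by (simp add: e_def)
      then have u: "u = e *\<^sub>R w2 + e *\<^sub>R w1" by (simp add: algebra_simps)
      have "card (P \<inter> hp w2 d2 \<inter> hp w1 d1) \<le> card (P \<inter> hp u c \<inter> hp w1 d1)"
        using card_hp_Int_mono[OF fin, of e e w2 d2 w1 c d1] 2 base d2(1)
        unfolding u[symmetric] by (simp add: e_def)
      then show False using f d1(2) by (simp add: Int_ac)
    qed
  qed
  then show ?thesis using that d1(1) d2(1) f unfolding w1_def w2_def by blast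
qed

lemma (in orthonormal_frame) far_arcs:
  assumes fin: "finite P" and base: "card (P \<inter> hp u c) = k" and k: "card P < 2 * k"
    and m: "2 * k < card P + m" "3 * m + card P \<le> 3 * k + 2"
  defines "A \<equiv> \<Union>t1\<in>thin P k m u c J. \<Union>t2\<in>thin P k m u c (- J). far_arc u J t1 t2"
  shows "acute_triples A" "clustered P k m A"
proof -
  note th = thin_halfplanes[OF fin base k m]
  let ?T1 = "thin P k m u c J" and ?T2 = "thin P k m u c (- J)"
  \<comment> \<open>Far arcs grow with their slopes and the larger of two thin slopes is thin, so
    finitely many members of the union fit into one far arc.\<close>
  have directed: "\<exists>t1\<in>?T1. \<exists>t2\<in>?T2. a \<in> far_arc u J t1 t2 \<and> b \<in> far_arc u J t1 t2 \<and> d \<in> far_arc u J t1 t2"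
    if abd: "a \<in> A" "b \<in> A" "d \<in> A" for a b d
  proof -
    obtain r1 r2 s1 s2 q1 q2 where mem: "r1 \<in> ?T1" "s1 \<in> ?T1" "q1 \<in> ?T1" "r2 \<in> ?T2" "s2 \<in> ?T2" "q2 \<in> ?T2"
      and abd: "a \<in> far_arc u J r1 r2" "b \<in> far_arc u J s1 s2" "d \<in> far_arc u J q1 q2"
      using abd unfolding A_def by blast
    define t1 t2 where "t1 = max r1 (max s1 q1)" and "t2 = max r2 (max s2 q2)"
    have "t1 \<in> ?T1" "t2 \<in> ?T2" using mem by (auto simp: t1_def t2_def max_def)
    moreover have "a \<in> far_arc u J t1 t2" "b \<in> far_arc u J t1 t2" "d \<in> far_arc u J t1 t2"
      using abd far_arc_mono[of r1 t1 r2 t2 u J] far_arc_mono[of s1 t1 s2 t2 u J]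
        far_arc_mono[of q1 t1 q2 t2 u J] unfolding t1_def t2_def by (auto simp: le_max_iff_disj)
    ultimately show ?thesis by blast
  qed
  show "acute_triples A"
    unfolding acute_triples_def
  proof (intro ballI)
    fix a b d assume "a \<in> A" "b \<in> A" "d \<in> A"
    then obtain t1 t2 where t: "t1 \<in> ?T1" "t2 \<in> ?T2"
      "a \<in> far_arc u J t1 t2" "b \<in> far_arc u J t1 t2" "d \<in> far_arc u J t1 t2"
      using directed by blast
    have "t1 + t2 < 0" using th[OF t(1,2)] by blast
    from acute_far_arc[OF this] show "\<exists>v. 0 < inner a v \<and> 0 < inner b v \<and> 0 < inner d v"
      using t(3-5) unfolding acute_triples_def by blast
  qed
  show "clustered P k m A"
    unfolding clustered_def
  proof (intro ballI allI impI)
    fix a b s t assume "a \<in> A" "b \<in> A" and ks: "k \<le> card (P \<inter> hp a s)" "k \<le> card (P \<inter> hp b t)"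
    then obtain t1 t2 where tt: "t1 \<in> ?T1" "t2 \<in> ?T2" "a \<in> far_arc u J t1 t2" "b \<in> far_arc u J t1 t2"
      using directed by blast
    obtain d1 d2 where d: "t1 + t2 < 0"
      "card (P \<inter> hp (J + t1 *\<^sub>R u) d1) = k" "card (P \<inter> hp (- J + t2 *\<^sub>R u) d2) = k"
      "m \<le> card (P \<inter> hp (J + t1 *\<^sub>R u) d1 \<inter> hp (- J + t2 *\<^sub>R u) d2)"
      using th[OF tt(1,2)] by blast
    obtain e f where a: "0 \<le> e" "0 \<le> f" "0 < e + f"
      "a = e *\<^sub>R (J + t1 *\<^sub>R u) + f *\<^sub>R (- J + t2 *\<^sub>R u)"
      using far_arc_cone[OF d(1) tt(3)] by blast
    obtain g h where b: "0 \<le> g" "0 \<le> h" "0 < g + h"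
      "b = g *\<^sub>R (J + t1 *\<^sub>R u) + h *\<^sub>R (- J + t2 *\<^sub>R u)"
      using far_arc_cone[OF d(1) tt(4)] by blast
    show "m \<le> card (P \<inter> hp a s \<inter> hp b t)"
      using card_hp_Int_cone[OF fin a(1,2) b(1,2) a(3) b(3) a(4) b(4) _ _ ks, of d1 d2] d by simp
  qed
qed

section \<open>The arcs cover all directions\<close>

text \<open>The minimal majority opposite to \<open>hp u c\<close> already shares fewer than
  \<open>m\<close> points with it; a tilt from \<open>- u\<close> towards \<open>J\<close> keeps
  this and gives a direction with a slope.\<close>

lemma (in orthonormal_frame) thin_nonempty:
  assumes fin: "finite P" and base: "card (P \<inter> hp u c) = k" and k: "card P < 2 * k"
    and m: "2 * k < card P + m" and anti: "card (P \<inter> hp (- u) d) = k"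
  shows "thin P k m u c J \<noteq> {}"
proof -
  have sep: "x = 0" if "inner (- u) x = 0" "inner J x = 0" for x
    using frame[of x] that by (simp add: inner_commute)
  obtain e r where e: "0 < e" and r: "card (P \<inter> hp (- u + e *\<^sub>R J) r) = k"
    "P \<inter> hp (- u + e *\<^sub>R J) r \<subseteq> hp (- u) d"
    using perturbed_hp[OF fin sep eq_imp_le[OF anti[symmetric]]] by metis
  have scale: "hp (- u + e *\<^sub>R J) r = hp (J + (- 1 / e) *\<^sub>R u) (r / e)"
    using e by (auto simp: hp_def inner_add_left inner_diff_left field_simps)
  have "card (P \<inter> hp u c \<inter> hp (- u + e *\<^sub>R J) r) \<le> card (P \<inter> hp u c \<inter> hp (- u) d)"
    by (rule card_mono) (use fin r(2) in auto)
  also have "\<dots> < m" using card_antipodal_hp[OF fin k base anti] m by linarith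
  finally have "- 1 / e \<in> thin P k m u c J" using r(1) unfolding thin_def scale by blast
  then show ?thesis by blast
qed

lemma (in orthonormal_frame) arcs_cover:
  assumes ne: "thin P k m u c J \<noteq> {}" "thin P k m u c (- J) \<noteq> {}" and b: "b \<noteq> 0"
  shows "b \<in> near_arc P k m u c J
    \<union> (\<Union>t1\<in>thin P k m u c J. \<Union>t2\<in>thin P k m u c (- J). far_arc u J t1 t2)
    \<union> near_arc P k m u c (- J)"
proof -
  define x y where "x = inner b u" and "y = inner b J"
  have bxy: "b = x *\<^sub>R u + y *\<^sub>R J" "b = x *\<^sub>R u + (- y) *\<^sub>R (- J)"
    using frame[of b] by (simp_all add: x_def y_def)
  \<comment> \<open>A far arc needs a thin slope on each side; these fill in for the side that
    \<open>b\<close> does not lie on.\<close>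
  obtain r1 r2 where r: "r1 \<in> thin P k m u c J" "r2 \<in> thin P k m u c (- J)" using ne by blast
  consider "0 < y" "\<forall>t\<in>thin P k m u c J. y * t < x" | t where "0 < y" "t \<in> thin P k m u c J" "x \<le> y * t"
    | "y < 0" "\<forall>t\<in>thin P k m u c (- J). - y * t < x" | t where "y < 0" "t \<in> thin P k m u c (- J)" "x \<le> - y * t"
    | "y = 0" "0 < x" | "y = 0" "x < 0" | "y = 0" "x = 0"
    by (metis linorder_neqE_linordered_idom not_less)
  then show ?thesis
  proof cases
    case 1
    then have "b \<in> near_arc P k m u c J" using bxy(1) unfolding near_arc_def by blast
    then show ?thesis by blast
  next
    case (2 t)
    then have "b \<in> far_arc u J t r2" using bxy(1) unfolding far_arc_def by blast
    then show ?thesis using 2 r by blast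
  next
    case 3
    then have "0 < - y" by simp
    then have "b \<in> near_arc P k m u c (- J)" using 3(2) bxy(2) unfolding near_arc_def by blast
    then show ?thesis by blast
  next
    case (4 t)
    then have "b \<in> far_arc u J r1 t" using bxy(1) unfolding far_arc_def by blast
    then show ?thesis using 4 r by blast
  next
    case 5
    then have "b \<in> near_arc P k m u c J" using bxy(1) unfolding near_arc_def by blast
    then show ?thesis by blast
  next
    case 6
    then have "b \<in> far_arc u J r1 r2" using bxy(1) unfolding far_arc_def by blast
    then show ?thesis using r by blast
  next
    case 7
    then show ?thesis using b bxy by simp
  qed
qed

section \<open>Coordinates in the plane and the choice of the parameters\<close>

lemma inner_real2: "inner (a::real^2) b = a $ 1 * b $ 1 + a $ 2 * b $ 2"
  by (simp add: inner_vec_def sum_2)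

lemma orthonormal_frame_real2:
  fixes u :: "real^2"
  assumes "inner u u = 1"
  shows "orthonormal_frame u (vector [- (u $ 2), u $ 1])"
proof
  have n: "u $ 1 * u $ 1 + u $ 2 * u $ 2 = 1" using assms by (simp add: inner_real2)
  show "inner u u = 1" by (rule assms)
  show "inner (vector [- (u $ 2), u $ 1] :: real^2) (vector [- (u $ 2), u $ 1]) = 1"
    using n by (simp add: inner_real2)
  show "inner u (vector [- (u $ 2), u $ 1]) = 0" by (simp add: inner_real2)
  fix b :: "real^2"
  have "b $ 1 * (u $ 1 * u $ 1 + u $ 2 * u $ 2) = b $ 1" "b $ 2 * (u $ 1 * u $ 1 + u $ 2 * u $ 2) = b $ 2"
    using n by simp_all
  then show "b = inner b u *\<^sub>R u + inner b (vector [- (u $ 2), u $ 1]) *\<^sub>R vector [- (u $ 2), u $ 1]"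
    by (simp add: vec_eq_iff forall_2 inner_real2 algebra_simps)
qed

lemma exists_generic_unit_vector:
  fixes P :: "(real^2) set"
  assumes "finite P"
  obtains u where "inner u u = 1" "inj_on (inner u) P"
proof -
  let ?e1 = "vector [1, 0] :: real^2" and ?e2 = "vector [0, 1] :: real^2"
  have "\<forall>\<^sub>F e in at_right (0::real). inj_on (inner (?e1 + e *\<^sub>R ?e2)) P"
    by (rule eventually_inj_on_inner[OF assms]) (simp add: inner_real2 vec_eq_iff forall_2)
  then obtain e where e: "inj_on (inner (?e1 + e *\<^sub>R ?e2)) P"
    using eventually_happens'[OF trivial_limit_at_right_real] by blast
  define w where "w = ?e1 + e *\<^sub>R ?e2"
  have "w $ 1 = 1" by (simp add: w_def)
  then have w: "w \<noteq> 0" by auto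
  show ?thesis
  proof (rule that)
    show "inner (sgn w) (sgn w) = 1" using w by (simp add: dot_square_norm norm_sgn)
    show "inj_on (inner (sgn w)) P"
      using e w unfolding w_def[symmetric] by (simp add: inj_on_def sgn_div_norm)
  qed
qed

theorem theorem4:
  fixes P :: "(real^2) set" and n :: nat
  assumes "finite P" and "card P = n" and "general_position P"
  shows "\<exists>p1 p2 p3 :: real^2.
           (\<forall>H. closed_halfplane H \<and> (p1 \<in> H \<or> p2 \<in> H \<or> p3 \<in> H)
                 \<longrightarrow> real (card (P \<inter> H)) \<ge> real n / 6) \<and>
           (\<forall>H. closed_halfplane H \<and> p1 \<in> H \<and> p2 \<in> H \<and> p3 \<in> H
                 \<longrightarrow> real (card (P \<inter> H)) \<ge> real n / 2)"
proof (cases "P = {}")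
  case True
  then show ?thesis using assms(2) by simp
next
  case ne: False
  note fin = assms(1)
  define k where "k = card P div 2 + 1"
  have n: "0 < card P" using fin ne by (simp add: card_gt_0_iff)
  have k: "card P < 2 * k" "k \<le> card P" using n unfolding k_def by presburger+
  obtain u where u: "inner u u = 1" "inj_on (inner u) P"
    using exists_generic_unit_vector[OF fin] by blast
  define J :: "real^2" where "J = vector [- (u $ 2), u $ 1]"
  interpret orthonormal_frame u J
    unfolding J_def by (rule orthonormal_frame_real2[OF u(1)])
  interpret N: orthonormal_frame u "- J" by (rule neg_J)
  interpret M: orthonormal_frame "- u" "- J" by (rule neg)
  show ?thesis
  \<comment> \<open>For at most six points \<open>m = 1\<close> suffices and two opposite half
    circles cover, one being listed twice. The general choice of \<open>m\<close> can fail here: six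
    points give \<open>k = 4\<close>, where \<open>3 * m + 6 \<le> 14\<close> allows at most 2 while
    antipodal overlaps are 2.\<close>
  proof (cases "card P \<le> 6")
    case True
    have cover: "a \<in> half_open_arc u J \<union> half_open_arc (- u) (- J) \<union> half_open_arc u J"
      if "a \<noteq> 0" for a
    proof -
      define x y where "x = inner a u" and "y = inner a J"
      have a: "a = x *\<^sub>R u + y *\<^sub>R J" "a = (- x) *\<^sub>R (- u) + (- y) *\<^sub>R (- J)"
        using frame[of a] by (simp_all add: x_def y_def)
      have "x \<noteq> 0 \<or> y \<noteq> 0" using that a by auto
      then have "(0 < y \<or> (y = 0 \<and> 0 < x)) \<or> (0 < - y \<or> (- y = 0 \<and> 0 < - x))" by linarith
      then show ?thesis using a unfolding half_open_arc_def by blast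
    qed
    have "card P \<le> 6 * 1" using True by simp
    from halfplane_points_from_cover[OF fin ne k_def this acute_half_open_arc
        M.acute_half_open_arc acute_half_open_arc clustered_one[OF fin k(1)]
        clustered_one[OF fin k(1)] clustered_one[OF fin k(1)] cover]
    show ?thesis unfolding assms(2) .
  next
    case False
    \<comment> \<open>The largest \<open>m\<close> with
      \<open>m \<le> 3 * k - card P - 2 * (m - 1)\<close>, as the count of the three halfplanes
      requires.\<close>
    define m where "m = (3 * k + 2 - card P) div 3"
    have k': "2 * k \<le> card P + 2" unfolding k_def by simp
    have "3 * m \<le> 3 * k + 2 - card P" "3 * k + 2 - card P \<le> 3 * m + 2" unfolding m_def by simp_all
    then have m: "2 * k < card P + m" "3 * m + card P \<le> 3 * k + 2" "card P \<le> 6 * m" "m \<le> k"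
      using False k k' by linarith+
    obtain c where c: "card (P \<inter> hp u c) = k" using exists_hp_of_card[OF fin k(2) u(2)] .
    have "inj_on (inner (- u)) P" using u(2) by (simp add: inj_on_def)
    then obtain d where d: "card (P \<inter> hp (- u) d) = k" using exists_hp_of_card[OF fin k(2)] by blast
    note T1 = thin_nonempty[OF fin c k(1) m(1) d]
    note T2 = N.thin_nonempty[OF fin c k(1) m(1) d]
    note far = far_arcs[OF fin c k(1) m(1,2)]
    from halfplane_points_from_cover[OF fin ne k_def m(3)
        acute_triples_subset[OF acute_half_open_arc near_arc_subset] far(1)
        acute_triples_subset[OF N.acute_half_open_arc near_arc_subset]
        clustered_near_arc[OF fin c m(4)] far(2) N.clustered_near_arc[OF fin c m(4)]
        arcs_cover[OF T1 T2]]
    show ?thesis unfolding assms(2) .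
  qed
qed

end
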